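(* Let $\triangle ABC$ be a (nondegenerate) triangle in the Euclidean plane, with circumradius $R$, inradius $r$, incenter $I$ and nine-point center $N$. Then $$|IN| = \tfrac12 R - r.$$
   Context: $|XY|$ denotes the Euclidean distance between points $X$ and $Y$. The circumradius $R$ is the radius of the circle through $A,B,C$. The incenter $I$ is the intersection point of the internal angle bisectors of the triangle, and the inradius $r$ is the radius of the incircle (the circle centered at $I$ tangent to the three sides). The nine-point center $N$ is the center of the nine-point circle, i.e. the circle passing through the midpoints of the three sides of the triangle; its radius is $\tfrac12 R$. *)

theory Defs
  imports "HOL-Analysis.Analysis"
begin

(* The unoriented angle PQR at the vertex Q, in [0, pi]; meaningful for P \<noteq> Q \<noteq> R. *)
definition angle :: "real ^ 2 \<Rightarrow> real ^ 2 \<Rightarrow> real ^ 2 \<Rightarrow> real" where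
  "angle P Q R = arccos (((P - Q) \<bullet> (R - Q)) / (norm (P - Q) * norm (R - Q)))"

(* The ray from Q that divides the angle PQR into two equal parts.  The condition on the sum
   excludes the opposite ray, whose points X also satisfy angle P Q X = angle X Q R. *)
definition internal_bisector :: "real ^ 2 \<Rightarrow> real ^ 2 \<Rightarrow> real ^ 2 \<Rightarrow> (real ^ 2) set" where
  "internal_bisector P Q R =
     insert Q {X. X \<noteq> Q \<and> angle P Q X = angle X Q R \<and>
                  angle P Q X + angle X Q R = angle P Q R}"

definition circumradius :: "real ^ 2 \<Rightarrow> real ^ 2 \<Rightarrow> real ^ 2 \<Rightarrow> real" where
  "circumradius A B C = (THE R. \<exists>Z. {A, B, C} \<subseteq> sphere Z R)"

definition incenter :: "real ^ 2 \<Rightarrow> real ^ 2 \<Rightarrow> real ^ 2 \<Rightarrow> real ^ 2" where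
  "incenter A B C =
     (THE I. I \<in> internal_bisector B A C \<inter> internal_bisector C B A \<inter> internal_bisector A C B)"

(* The circle meets the line PQ in exactly one point, and that point lies on the side PQ. *)
definition tangent_to_side :: "real ^ 2 \<Rightarrow> real \<Rightarrow> real ^ 2 \<Rightarrow> real ^ 2 \<Rightarrow> bool" where
  "tangent_to_side Z r P Q \<longleftrightarrow>
     r > 0 \<and> (\<exists>T \<in> closed_segment P Q. sphere Z r \<inter> affine hull {P, Q} = {T})"

definition inradius :: "real ^ 2 \<Rightarrow> real ^ 2 \<Rightarrow> real ^ 2 \<Rightarrow> real" where
  "inradius A B C =
     (THE r. tangent_to_side (incenter A B C) r B C \<and>
             tangent_to_side (incenter A B C) r C A \<and>
             tangent_to_side (incenter A B C) r A B)"

definition nine_point_center :: "real ^ 2 \<Rightarrow> real ^ 2 \<Rightarrow> real ^ 2 \<Rightarrow> real ^ 2" where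
  "nine_point_center A B C =
     (THE N. \<exists>\<rho>. {midpoint B C, midpoint C A, midpoint A B} \<subseteq> sphere N \<rho>)"

end

theory Submission
  imports Defs
begin

text \<open>
  Write \<open>a, b, c\<close> for the side lengths, \<open>x = (b + c - a) / 2\<close> and cyclically \<open>y, z\<close> for the
  tangent lengths, and \<open>s = x + y + z\<close> for the semiperimeter.  Take the circumcenter \<open>O\<close> as the
  origin, so that the vertices are vectors of length \<open>R\<close>.  Then \<open>N = (A + B + C) / 2\<close> and
  \<open>I = (a A + b B + c C) / (2 s)\<close>, and because \<open>s - a = x\<close> the difference is a combination
  with nonnegative coefficients:
  \<open>N - I = (x A + y B + z C) / (2 s)\<close>.

  Scalar products of vectors on a sphere are determined by distances, for instance
  \<open>2 (A \<bullet> B) = 2 R\<^sup>2 - c\<^sup>2\<close>.  Expanding the square (\<open>norm_sum3_sphere\<close>) gives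
  \<open>|IN|\<^sup>2 = R\<^sup>2 / 4 - (y z a\<^sup>2 + z x b\<^sup>2 + x y c\<^sup>2) / (4 s\<^sup>2)\<close>, and substituting
  \<open>a = y + z\<close> and so on turns this into \<open>R\<^sup>2 / 4 - a b c / (4 s) + x y z / s\<close>.  The last term is
  \<open>r\<^sup>2\<close> (\<open>inradius_eq\<close>).  The middle one is \<open>R r\<close>: Heron's formula (\<open>heron\<close>) gives the area
  \<open>r s\<close>, and \<open>circumradius_sides\<close> says that the area is also \<open>a b c / (4 R)\<close>.  Hence
  \<open>|IN|\<^sup>2 = (R / 2 - r)\<^sup>2\<close>, and it remains to extract the root.  For that \<open>2 r \<le> R\<close> is needed;
  it is equivalent to \<open>8 x y z \<le> (y + z) (z + x) (x + y)\<close>.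

  The geometry lies in the identification of the four quantities, each characterized by a
  unique-existence condition.  The points equidistant from three points solve a linear system
  whose determinant is nonzero; this settles \<open>R\<close> and \<open>N\<close>.  The angle condition on a bisector
  is turned into membership in the ray spanned by the sum of the two unit vectors along the sides
  (\<open>internal_bisector_eq_ray\<close>); two such rays meet only in the barycenter with weights
  \<open>a, b, c\<close>.  Finally a circle meets a line in a single point exactly when that point is the foot
  of the perpendicular from the center (\<open>tangent_to_side_iff\<close>), which for the incenter and the
  side \<open>BC\<close> is the point at distance \<open>y\<close> from \<open>B\<close>.
\<close>

section \<open>Linear algebra in the plane\<close>

definition cross2 :: "real ^ 2 \<Rightarrow> real ^ 2 \<Rightarrow> real" where
  "cross2 u v = u $ 1 * v $ 2 - u $ 2 * v $ 1"

lemma inner_real2: "(u :: real ^ 2) \<bullet> v = u $ 1 * v $ 1 + u $ 2 * v $ 2"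
  by (simp add: inner_vec_def sum_2)

lemma cross2_square: "(cross2 u v)\<^sup>2 = (u \<bullet> u) * (v \<bullet> v) - (u \<bullet> v)\<^sup>2"
  by (simp add: cross2_def inner_real2 power2_eq_square algebra_simps)

text \<open>By Lagrange's identity, \<open>cross2 u v\<close> vanishes exactly in the equality case of the Cauchy-Schwarz
  inequality.\<close>

lemma cross2_eq_0_iff: "cross2 u v = 0 \<longleftrightarrow> collinear {0, u, v}"
proof -
  have "cross2 u v = 0 \<longleftrightarrow> (cross2 u v)\<^sup>2 = 0" by simp
  also have "\<dots> \<longleftrightarrow> (u \<bullet> v)\<^sup>2 = (norm u * norm v)\<^sup>2"
    unfolding cross2_square by (auto simp: power_mult_distrib power2_norm_eq_inner)
  also have "\<dots> \<longleftrightarrow> \<bar>u \<bullet> v\<bar> = norm u * norm v"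
    using power2_eq_iff_nonneg[of "\<bar>u \<bullet> v\<bar>" "norm u * norm v"] by simp
  finally show ?thesis
    by (simp add: norm_cauchy_schwarz_equal)
qed

lemma cross2_nonzero:
  assumes "\<not> collinear {A, B, C}"
  shows "cross2 (B - A) (C - A) \<noteq> 0"
proof -
  have "{A, B, C} = {B, A, C}" by auto
  then have "collinear {A, B, C} \<longleftrightarrow> collinear {0, B - A, C - A}"
    by (metis NO_MATCH_def collinear_3)
  with assms show ?thesis by (simp add: cross2_eq_0_iff)
qed

lemma cross2_independent:
  assumes "cross2 u v \<noteq> 0" "p *\<^sub>R u + q *\<^sub>R v = 0"
  shows "p = 0" "q = 0"
proof -
  have e: "p * u $ 1 + q * v $ 1 = 0" "p * u $ 2 + q * v $ 2 = 0"
    using assms(2) by (simp_all add: vec_eq_iff forall_2)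
  have "p * cross2 u v = v $ 2 * (p * u $ 1 + q * v $ 1) - v $ 1 * (p * u $ 2 + q * v $ 2)"
    by (simp add: cross2_def algebra_simps)
  then show "p = 0" using e assms(1) by simp
  have "q * cross2 u v = u $ 1 * (p * u $ 2 + q * v $ 2) - u $ 2 * (p * u $ 1 + q * v $ 1)"
    by (simp add: cross2_def algebra_simps)
  then show "q = 0" using e assms(1) by simp
qed

text \<open>A vector of the plane can be reconstructed from its scalar products with two independent vectors;
  this is the resulting formula for its squared length.  It gives both the uniqueness of
  equidistant points (a vector orthogonal to \<open>u\<close> and \<open>v\<close> is zero) and the value of the
  circumradius.\<close>

lemma norm_from_inner_products:
  "(cross2 u v)\<^sup>2 * (w \<bullet> w) =
     (w \<bullet> u)\<^sup>2 * (v \<bullet> v) + (w \<bullet> v)\<^sup>2 * (u \<bullet> u) - 2 * (w \<bullet> u) * (w \<bullet> v) * (u \<bullet> v)"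
  unfolding cross2_def inner_real2 by algebra

lemma cross2_dual_basis:
  assumes "cross2 u v \<noteq> 0"
  shows "\<exists>w. w \<bullet> u = p \<and> w \<bullet> v = q"
proof -
  define d where "d = cross2 u v"
  define w :: "real ^ 2" where
    "w = vector [(p * v $ 2 - q * u $ 2) / d, (q * u $ 1 - p * v $ 1) / d]"
  have d: "d \<noteq> 0" "d = u $ 1 * v $ 2 - u $ 2 * v $ 1"
    using assms by (simp_all add: d_def cross2_def)
  have "w \<bullet> u = p * (u $ 1 * v $ 2 - u $ 2 * v $ 1) / d"
    by (simp add: inner_real2 w_def add_divide_distrib diff_divide_distrib algebra_simps)
  moreover have "w \<bullet> v = q * (u $ 1 * v $ 2 - u $ 2 * v $ 1) / d"
    by (simp add: inner_real2 w_def add_divide_distrib diff_divide_distrib algebra_simps)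
  ultimately show ?thesis using d by auto
qed

section \<open>Circumcircle and nine-point center\<close>

text \<open>The perpendicular bisector of \<open>PQ\<close> is a line, so the conditions on a circumcenter are linear.\<close>

lemma dist_eq_iff_inner:
  fixes Z P Q :: "'a :: real_inner"
  shows "dist Z P = dist Z Q \<longleftrightarrow> (Z - P) \<bullet> (Q - P) = (dist P Q)\<^sup>2 / 2"
proof -
  have "dist Z P = dist Z Q \<longleftrightarrow> (dist Z P)\<^sup>2 = (dist Z Q)\<^sup>2"
    by (simp add: power2_eq_iff_nonneg)
  also have "\<dots> \<longleftrightarrow> (Z - P) \<bullet> (Q - P) = (dist P Q)\<^sup>2 / 2"
    by (simp add: dist_norm power2_norm_eq_inner algebra_simps inner_commute)
  finally show ?thesis .
qed

lemma equidistant_point_exists: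
  fixes A B C :: "real ^ 2"
  assumes "\<not> collinear {A, B, C}"
  shows "\<exists>Z. dist Z A = dist Z B \<and> dist Z A = dist Z C"
proof -
  obtain w where "w \<bullet> (B - A) = (dist A B)\<^sup>2 / 2" "w \<bullet> (C - A) = (dist A C)\<^sup>2 / 2"
    using cross2_dual_basis[OF cross2_nonzero[OF assms]] by blast
  then show ?thesis
    by (intro exI[of _ "A + w"]) (simp add: dist_eq_iff_inner)
qed

lemma equidistant_point_unique:
  fixes A B C :: "real ^ 2"
  assumes "cross2 (B - A) (C - A) \<noteq> 0"
    and "dist Y A = dist Y B" "dist Y A = dist Y C"
    and "dist Z A = dist Z B" "dist Z A = dist Z C"
  shows "Y = Z"
proof -
  have "(Y - Z) \<bullet> (B - A) = (Y - A) \<bullet> (B - A) - (Z - A) \<bullet> (B - A)"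
       "(Y - Z) \<bullet> (C - A) = (Y - A) \<bullet> (C - A) - (Z - A) \<bullet> (C - A)"
    by (simp_all add: inner_diff_left)
  then have "(Y - Z) \<bullet> (B - A) = 0" "(Y - Z) \<bullet> (C - A) = 0"
    using dist_eq_iff_inner[of Y A B] dist_eq_iff_inner[of Y A C]
      dist_eq_iff_inner[of Z A B] dist_eq_iff_inner[of Z A C] assms(2-) by simp_all
  then show ?thesis
    using norm_from_inner_products[of "B - A" "C - A" "Y - Z"] assms(1) by simp
qed

lemma circumradius_eq:
  assumes "\<not> collinear {A, B, C}" "dist Z A = dist Z B" "dist Z A = dist Z C"
  shows "circumradius A B C = dist Z A"
  unfolding circumradius_def
proof (rule the_equality)
  show "\<exists>Y. {A, B, C} \<subseteq> sphere Y (dist Z A)"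
    using assms by (intro exI[of _ Z]) auto
next
  fix R assume "\<exists>Y. {A, B, C} \<subseteq> sphere Y R"
  then obtain Y where Y: "{A, B, C} \<subseteq> sphere Y R" by blast
  then have "Y = Z"
    using equidistant_point_unique[OF cross2_nonzero[OF assms(1)], of Y Z] assms by simp
  then show "R = dist Z A" using Y by simp
qed

text \<open>The medial triangle is the image of \<open>ABC\<close> under the homothety with ratio \<open>-1/2\<close> about the
  centroid, which maps \<open>X\<close> to \<open>(A + B + C - X) / 2\<close> and hence circumcenter to circumcenter.\<close>

lemma nine_point_center_eq:
  assumes "\<not> collinear {A, B, C}" "dist Z A = dist Z B" "dist Z A = dist Z C"
  shows "nine_point_center A B C = (1/2) *\<^sub>R (A + B + C - Z)"
    (is "_ = ?N")
  unfolding nine_point_center_def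
proof (rule the_equality)
  have mid: "dist ?N (midpoint P Q) = dist Z S / 2"
    if "A + B + C = P + Q + S" for P Q S
  proof -
    have "?N - midpoint P Q = (1/2) *\<^sub>R (S - Z)"
      unfolding that midpoint_def by (simp add: algebra_simps)
    then show ?thesis by (simp add: dist_norm norm_minus_commute)
  qed
  have N: "dist ?N (midpoint B C) = dist Z A / 2" "dist ?N (midpoint C A) = dist Z A / 2"
    "dist ?N (midpoint A B) = dist Z A / 2"
    using mid[of B C A] mid[of C A B] mid[of A B C] assms(2,3) by (simp_all add: algebra_simps)
  then show "\<exists>\<rho>. {midpoint B C, midpoint C A, midpoint A B} \<subseteq> sphere ?N \<rho>"
    by auto
  fix M assume "\<exists>\<rho>. {midpoint B C, midpoint C A, midpoint A B} \<subseteq> sphere M \<rho>"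
  then have M: "dist M (midpoint B C) = dist M (midpoint C A)"
    "dist M (midpoint B C) = dist M (midpoint A B)"
    by auto
  \<comment> \<open>The medial triangle has a quarter of the area, so it is nondegenerate as well.\<close>
  have "cross2 (midpoint C A - midpoint B C) (midpoint A B - midpoint B C)
      = cross2 (B - A) (C - A) / 4"
    by (simp add: cross2_def midpoint_def field_simps)
  then show "M = ?N"
    using equidistant_point_unique[OF _ M] N cross2_nonzero[OF assms(1)] by simp
qed

section \<open>Internal bisectors and the incenter\<close>

text \<open>The double angle formula alone does not determine the half angle: the sign condition on \<open>p\<close>
  says that half of an angle in \<open>[0, \<pi>]\<close> is at most a right angle.\<close>

lemma arccos_half_iff:
  assumes "-1 \<le> p" "p \<le> 1" "-1 \<le> q" "q \<le> 1"
  shows "2 * arccos p = arccos q \<longleftrightarrow> 0 \<le> p \<and> q = 2 * p\<^sup>2 - 1"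
proof
  assume h: "2 * arccos p = arccos q"
  then have "arccos p \<le> pi / 2" using arccos_ubound[of q] assms by linarith
  then have "0 \<le> cos (arccos p)"
    using arccos_lbound[of p] assms by (intro cos_ge_zero) (auto intro: order_trans[of _ 0])
  moreover have "q = cos (2 * arccos p)" using h assms by simp
  ultimately show "0 \<le> p \<and> q = 2 * p\<^sup>2 - 1"
    using assms by (simp add: cos_double_cos)
next
  assume h: "0 \<le> p \<and> q = 2 * p\<^sup>2 - 1"
  have "cos (2 * arccos p) = q" using h assms by (simp add: cos_double_cos)
  moreover have "0 \<le> arccos p" "arccos p \<le> pi / 2"
    using h assms arccos_lbound[of p] arccos_le_pi2[of p] by auto
  ultimately show "2 * arccos p = arccos q"
    using arccos_cos[of "2 * arccos p"] by simp
qed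

lemma cosine_bounds:
  fixes u v :: "'a :: real_inner"
  shows "-1 \<le> u \<bullet> v / (norm u * norm v)" "u \<bullet> v / (norm u * norm v) \<le> 1"
proof -
  have "\<bar>u \<bullet> v / (norm u * norm v)\<bar> \<le> 1"
    using Cauchy_Schwarz_ineq2[of u v] by (simp add: divide_le_eq abs_mult)
  then show "-1 \<le> u \<bullet> v / (norm u * norm v)" "u \<bullet> v / (norm u * norm v) \<le> 1"
    by (simp_all only: abs_le_iff minus_le_iff)
qed

text \<open>The direction \<open>m\<close> is the sum of the unit vectors \<open>u / |u|\<close> and \<open>v / |v|\<close>, scaled by \<open>|u| |v|\<close>
  to avoid divisions; if \<open>g\<close> is the cosine of the angle at \<open>Q\<close>, then \<open>|m|\<close> is \<open>2 |u| |v|\<close> times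
  the cosine of the half angle.  A vector \<open>x\<close> that makes this half angle with both \<open>u\<close> and \<open>v\<close>
  therefore satisfies \<open>m \<bullet> x = |m| |x|\<close>, and equality in the Cauchy-Schwarz inequality makes it
  a positive multiple of \<open>m\<close>.\<close>

lemma internal_bisector_eq_ray:
  assumes "\<not> collinear {P, Q, R}"
  shows "internal_bisector P Q R =
    {Q + t *\<^sub>R (dist Q R *\<^sub>R (P - Q) + dist Q P *\<^sub>R (R - Q)) | t. 0 \<le> t}"
proof -
  define u v where "u = P - Q" and "v = R - Q"
  define m where "m = norm v *\<^sub>R u + norm u *\<^sub>R v"
  define g where "g = u \<bullet> v / (norm u * norm v)"
  have "{P, Q, R} = {Q, P, R}" by auto
  with assms have "cross2 u v \<noteq> 0" using cross2_nonzero[of Q P R] by (simp add: u_def v_def)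
  then have u: "norm u > 0" and v: "norm v > 0" and "m \<noteq> 0"
    using cross2_independent[of u v "norm v" "norm u"]
    by (auto simp: m_def cross2_def)
  then have m: "norm m > 0" by simp
  have uv: "u \<bullet> v = norm u * norm v * g" using u v by (simp add: g_def)
  have mm: "(norm m)\<^sup>2 = 2 * (norm u)\<^sup>2 * (norm v)\<^sup>2 * (1 + g)"
  proof -
    have "(norm m)\<^sup>2 = m \<bullet> m" by (rule power2_norm_eq_inner)
    also have "\<dots> = (norm v)\<^sup>2 * (u \<bullet> u) + (norm u)\<^sup>2 * (v \<bullet> v) + 2 * norm u * norm v * (u \<bullet> v)"
      unfolding m_def
      by (simp add: inner_add_left inner_add_right inner_commute power2_eq_square)
    also have "\<dots> = 2 * (norm u)\<^sup>2 * (norm v)\<^sup>2 * (1 + g)"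
      by (simp add: uv flip: power2_norm_eq_inner) (simp add: power2_eq_square algebra_simps)
    finally show ?thesis .
  qed
  have um: "u \<bullet> m = (norm u)\<^sup>2 * norm v * (1 + g)"
    by (simp add: m_def inner_add_right uv flip: power2_norm_eq_inner)
       (simp add: algebra_simps power2_eq_square)
  have vm: "m \<bullet> v = (norm v)\<^sup>2 * norm u * (1 + g)"
    by (simp add: m_def inner_add_left uv flip: power2_norm_eq_inner)
       (simp add: algebra_simps power2_eq_square)
  have g: "-1 \<le> g" "g \<le> 1" unfolding g_def by (rule cosine_bounds)+
  have bisects: "X \<in> internal_bisector P Q R \<longleftrightarrow> (\<exists>t\<ge>0. X - Q = t *\<^sub>R m)" for X
  proof (cases "X = Q")
    case True
    then show ?thesis by (auto simp: internal_bisector_def intro!: exI[of _ 0])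
  next
    case False
    define x where "x = X - Q"
    define p q where "p = u \<bullet> x / (norm u * norm x)" and "q = x \<bullet> v / (norm x * norm v)"
    have x: "norm x > 0" using False by (simp add: x_def)
    have pq: "-1 \<le> p" "p \<le> 1" "-1 \<le> q" "q \<le> 1"
      unfolding p_def q_def by (rule cosine_bounds)+
    have "X \<in> internal_bisector P Q R \<longleftrightarrow> arccos p = arccos q \<and> arccos p + arccos q = arccos g"
      using False by (simp add: internal_bisector_def angle_def p_def q_def g_def u_def v_def x_def)
    also have "\<dots> \<longleftrightarrow> p = q \<and> 2 * arccos p = arccos g"
      using pq arccos_eq_iff[of p q] by (auto simp: abs_le_iff)
    also have "\<dots> \<longleftrightarrow> p = q \<and> 0 \<le> p \<and> g = 2 * p\<^sup>2 - 1"
      using arccos_half_iff[of p g] pq g by simp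
    also have "\<dots> \<longleftrightarrow> (\<exists>t\<ge>0. x = t *\<^sub>R m)"
    proof
      assume h: "p = q \<and> 0 \<le> p \<and> g = 2 * p\<^sup>2 - 1"
      have "(norm m)\<^sup>2 = (2 * norm u * norm v * p)\<^sup>2"
        using h mm by (simp add: power_mult_distrib)
      then have nm: "norm m = 2 * norm u * norm v * p"
        using h by (subst (asm) power2_eq_iff_nonneg) auto
      have "u \<bullet> x = norm u * norm x * p" "v \<bullet> x = norm v * norm x * p"
        using h u v x by (simp_all add: p_def q_def inner_commute) (simp add: h field_simps)
      moreover have "m \<bullet> x = norm v * (u \<bullet> x) + norm u * (v \<bullet> x)"
        by (simp add: m_def inner_add_left)
      ultimately have "m \<bullet> x = norm m * norm x"
        by (simp add: nm)
      then have "norm m *\<^sub>R x = norm x *\<^sub>R m" by (simp add: norm_cauchy_schwarz_eq)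
      then have "x = (norm x / norm m) *\<^sub>R m" using m by (simp add: eq_vector_fraction_iff)
      then show "\<exists>t\<ge>0. x = t *\<^sub>R m" by (intro exI[of _ "norm x / norm m"]) auto
    next
      assume "\<exists>t\<ge>0. x = t *\<^sub>R m"
      then obtain t where t: "t > 0" "x = t *\<^sub>R m" using x by (auto simp: le_less)
      have p: "p = norm u * norm v * (1 + g) / norm m"
        using t u v m by (simp add: p_def um field_simps power2_eq_square)
      have q: "q = norm u * norm v * (1 + g) / norm m"
        using t u v m by (simp add: q_def vm field_simps power2_eq_square)
      have "0 \<le> p" using g by (simp add: p)
      have "1 + g \<noteq> 0" using mm m by auto
      have "p\<^sup>2 = (norm u)\<^sup>2 * (norm v)\<^sup>2 * (1 + g)\<^sup>2 / (norm m)\<^sup>2"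
        by (simp add: p power_divide power_mult_distrib)
      also have "\<dots> = (1 + g) / 2"
      proof -
        have "k * d\<^sup>2 / (2 * k * d) = d / 2" if "k \<noteq> 0" "d \<noteq> 0" for k d :: real
          using that by (simp add: power2_eq_square)
        from this[of "(norm u)\<^sup>2 * (norm v)\<^sup>2" "1 + g"] show ?thesis
          unfolding mm using u v \<open>1 + g \<noteq> 0\<close> by (simp add: mult.assoc)
      qed
      finally show "p = q \<and> 0 \<le> p \<and> g = 2 * p\<^sup>2 - 1"
        using p q \<open>0 \<le> p\<close> by simp
    qed
    finally show ?thesis by (simp add: x_def)
  qed
  have "dist Q R *\<^sub>R (P - Q) + dist Q P *\<^sub>R (R - Q) = m"
    by (simp add: m_def u_def v_def dist_norm norm_minus_commute)
  then show ?thesis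
    using bisects by (auto simp: algebra_simps) 
qed

definition side_barycenter :: "real ^ 2 \<Rightarrow> real ^ 2 \<Rightarrow> real ^ 2 \<Rightarrow> real ^ 2" where
  "side_barycenter A B C = (1 / (dist B C + dist C A + dist A B)) *\<^sub>R
     (dist B C *\<^sub>R A + dist C A *\<^sub>R B + dist A B *\<^sub>R C)"

lemma side_barycenter_rotate: "side_barycenter A B C = side_barycenter B C A"
  by (simp add: side_barycenter_def add_ac)

text \<open>Seen from a vertex the weighted mean lies in the direction used in
  \<open>internal_bisector_eq_ray\<close>.\<close>

lemma side_barycenter_from_vertex:
  assumes "A \<noteq> B"
  shows "side_barycenter A B C = A + (1 / (dist B C + dist C A + dist A B)) *\<^sub>R
    (dist A C *\<^sub>R (B - A) + dist A B *\<^sub>R (C - A))"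
proof -
  define s where "s = dist B C + dist C A + dist A B"
  have "s > 0" using assms unfolding s_def by (simp add: add_nonneg_pos)
  then have "A = (1 / s) *\<^sub>R (s *\<^sub>R A)" by simp
  moreover have "dist B C *\<^sub>R A + dist C A *\<^sub>R B + dist A B *\<^sub>R C =
     s *\<^sub>R A + (dist A C *\<^sub>R (B - A) + dist A B *\<^sub>R (C - A))"
    by (simp add: s_def algebra_simps dist_commute)
  ultimately show ?thesis
    unfolding side_barycenter_def s_def[symmetric] by (metis scaleR_right_distrib)
qed

lemma side_barycenter_on_bisector:
  assumes "\<not> collinear {A, B, C}"
  shows "side_barycenter A B C \<in> internal_bisector B A C"
proof -
  have "\<not> collinear {B, A, C}" "A \<noteq> B" using assms by (auto simp: insert_commute)
  then show ?thesis
    by (subst internal_bisector_eq_ray, simp, subst side_barycenter_from_vertex) auto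
qed

text \<open>The vectors \<open>B - A\<close> and \<open>C - A\<close> are independent, so comparing coefficients shows that the
  bisectors from \<open>A\<close> and \<open>B\<close> have only one common point.  By symmetry this point lies on the
  third bisector too.\<close>

lemma incenter_eq:
  assumes "\<not> collinear {A, B, C}"
  shows "incenter A B C = side_barycenter A B C"
  unfolding incenter_def
proof (rule the_equality)
  have "\<not> collinear {B, C, A}" "\<not> collinear {C, A, B}"
    using assms by (simp_all add: insert_commute)
  then show "side_barycenter A B C \<in>
      internal_bisector B A C \<inter> internal_bisector C B A \<inter> internal_bisector A C B"
    using assms side_barycenter_on_bisector[of A B C] side_barycenter_on_bisector[of B C A]
      side_barycenter_on_bisector[of C A B] side_barycenter_rotate
    by (metis IntI)
next
  fix X
  assume "X \<in> internal_bisector B A C \<inter> internal_bisector C B A \<inter> internal_bisector A C B"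
  moreover have "\<not> collinear {B, A, C}" "\<not> collinear {C, B, A}" "A \<noteq> B"
    using assms by (auto simp: insert_commute)
  ultimately have "\<exists>s. X = A + s *\<^sub>R (dist A C *\<^sub>R (B - A) + dist A B *\<^sub>R (C - A))"
    "\<exists>t. X = B + t *\<^sub>R (dist B A *\<^sub>R (C - B) + dist B C *\<^sub>R (A - B))"
    using internal_bisector_eq_ray[of B A C] internal_bisector_eq_ray[of C B A] by blast+
  then obtain s t where
    s: "X = A + s *\<^sub>R (dist A C *\<^sub>R (B - A) + dist A B *\<^sub>R (C - A))" and
    t: "X = B + t *\<^sub>R (dist B A *\<^sub>R (C - B) + dist B C *\<^sub>R (A - B))"
    by blast
  define d where "d = dist B C + dist C A + dist A B"
  \<comment> \<open>The difference of the two expressions for \<open>X\<close>, in the basis \<open>B - A\<close>, \<open>C - A\<close>.\<close>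
  have "(s * dist A C - 1 + t * (dist A B + dist B C)) *\<^sub>R (B - A)
        + ((s - t) * dist A B) *\<^sub>R (C - A) = 0"
    using trans[OF s[symmetric] t] by (simp add: algebra_simps dist_commute)
  note coeffs = cross2_independent[OF cross2_nonzero[OF assms] this]
  have "s = t" using coeffs(2) \<open>A \<noteq> B\<close> by simp
  then have "s * d = 1" using coeffs(1) by (simp add: d_def algebra_simps dist_commute)
  then have "s = 1 / d" by (metis mult_eq_0_iff nonzero_eq_divide_eq zero_neq_one)
  then show "X = side_barycenter A B C"
    using s \<open>A \<noteq> B\<close> by (simp add: side_barycenter_from_vertex d_def)
qed

section \<open>Tangency and the inradius\<close>

text \<open>The intersection of a circle with a line is symmetric about the foot \<open>T\<close> of the perpendicular
  from the center.  If it is a single point, this point must be \<open>T\<close>; conversely, by Pythagoras,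
  every other point of the line is farther from \<open>Z\<close> than \<open>T\<close>.\<close>

lemma tangent_to_side_iff:
  assumes T: "T \<in> closed_segment P Q" and perp: "(Z - T) \<bullet> (Q - P) = 0"
  shows "tangent_to_side Z r P Q \<longleftrightarrow> 0 < r \<and> r = dist Z T"
proof -
  have Tl: "T \<in> affine hull {P, Q}"
    using T by (meson closed_segment_subset affine_imp_convex affine_affine_hull hull_inc
        insertI1 insertI2 subsetD)
  have on_line: "\<exists>k. Y = T + k *\<^sub>R (Q - P)" if Y: "Y \<in> affine hull {P, Q}" for Y
  proof -
    obtain k where "Y = P + k *\<^sub>R (Q - P)" using Y by (auto simp: affine_hull_2_alt)
    moreover obtain l where "T = P + l *\<^sub>R (Q - P)" using Tl by (auto simp: affine_hull_2_alt)
    ultimately have "Y = T + (k - l) *\<^sub>R (Q - P)" by (simp add: scaleR_diff_left)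
    then show ?thesis by blast
  qed
  have line_mem: "T + k *\<^sub>R (Q - P) \<in> affine hull {P, Q}" for k
  proof -
    obtain l where "T = P + l *\<^sub>R (Q - P)"
      using Tl by (auto simp: affine_hull_2_alt)
    then have "T + k *\<^sub>R (Q - P) = P + (l + k) *\<^sub>R (Q - P)" by (simp add: algebra_simps)
    then show ?thesis by (auto simp: affine_hull_2_alt)
  qed
  have pythagoras: "(dist Z (T + k *\<^sub>R (Q - P)))\<^sup>2 = (dist Z T)\<^sup>2 + (k * dist P Q)\<^sup>2" for k
  proof -
    have "(dist Z (T + k *\<^sub>R (Q - P)))\<^sup>2 = (norm ((Z - T) - k *\<^sub>R (Q - P)))\<^sup>2"
      by (simp only: dist_norm diff_diff_add)
    also have "\<dots> = (dist Z T)\<^sup>2 + (k * dist P Q)\<^sup>2"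
      using norm_add_Pythagorean[of "Z - T" "- (k *\<^sub>R (Q - P))"] perp
      by (simp add: orthogonal_def dist_norm norm_minus_commute[of P Q] power_mult_distrib)
    finally show ?thesis .
  qed
  show ?thesis
  proof
    assume "tangent_to_side Z r P Q"
    then obtain S where r: "r > 0" and S: "sphere Z r \<inter> affine hull {P, Q} = {S}"
      unfolding tangent_to_side_def by blast
    then obtain k where k: "S = T + k *\<^sub>R (Q - P)" using on_line by blast
    \<comment> \<open>The mirror image of \<open>S\<close> in \<open>T\<close> lies in the intersection as well.\<close>
    have "(dist Z (T + (-k) *\<^sub>R (Q - P)))\<^sup>2 = (dist Z S)\<^sup>2"
      unfolding k pythagoras by simp
    then have "dist Z (T + (-k) *\<^sub>R (Q - P)) = r"
      using S by (auto simp: power2_eq_iff_nonneg)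
    then have "T + (-k) *\<^sub>R (Q - P) \<in> {S}"
      unfolding S[symmetric] using line_mem[of "-k"] by simp
    then have "k *\<^sub>R (Q - P) = - (k *\<^sub>R (Q - P))" unfolding k by simp
    then have "2 *\<^sub>R (k *\<^sub>R (Q - P)) = 0" by (simp only: scaleR_2 eq_neg_iff_add_eq_0)
    then have "S = T" unfolding k by simp
    then show "0 < r \<and> r = dist Z T" using S r by auto
  next
    assume r: "0 < r \<and> r = dist Z T"
    have "Y = T" if Y: "Y \<in> sphere Z r" "Y \<in> affine hull {P, Q}" for Y
    proof -
      obtain k where k: "Y = T + k *\<^sub>R (Q - P)" using on_line Y by blast
      then have "(k * dist P Q)\<^sup>2 = 0" using pythagoras[of k] r Y by simp
      then show ?thesis using k by auto
    qed
    then have "sphere Z r \<inter> affine hull {P, Q} = {T}" using r Tl by auto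
    then show "tangent_to_side Z r P Q" using r T unfolding tangent_to_side_def by blast
  qed
qed

lemma heron:
  fixes A B C :: "real ^ 2"
  defines "a \<equiv> dist B C" and "b \<equiv> dist C A" and "c \<equiv> dist A B"
  shows "4 * (cross2 (B - A) (C - A))\<^sup>2 = (a + b + c) * (b + c - a) * (c + a - b) * (a + b - c)"
proof -
  have "a\<^sup>2 = b\<^sup>2 + c\<^sup>2 - 2 * ((B - A) \<bullet> (C - A))"
    unfolding a_def b_def c_def dist_norm power2_norm_eq_inner
    by (simp add: algebra_simps inner_commute)
  then have "4 * ((B - A) \<bullet> (C - A))\<^sup>2 = (b\<^sup>2 + c\<^sup>2 - a\<^sup>2)\<^sup>2"
    by (simp add: power_mult_distrib)
  moreover have "(B - A) \<bullet> (B - A) = c\<^sup>2" "(C - A) \<bullet> (C - A) = b\<^sup>2"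
    by (simp_all add: b_def c_def dist_norm norm_minus_commute flip: power2_norm_eq_inner)
  ultimately have "4 * (cross2 (B - A) (C - A))\<^sup>2 = 4 * b\<^sup>2 * c\<^sup>2 - (b\<^sup>2 + c\<^sup>2 - a\<^sup>2)\<^sup>2"
    by (simp add: cross2_square algebra_simps)
  then show ?thesis by (simp add: power2_eq_square algebra_simps)
qed

text \<open>The foot of the perpendicular from the incenter to \<open>BC\<close> is at distance \<open>(c + a - b) / 2\<close> from
  \<open>B\<close>, and the triangle inequalities place it on the side.  The squared distance \<open>h\<close> of the
  incenter from this foot is symmetric in the three sides, which is why one circle touches them
  all.\<close>

lemma incircle_tangent_to_side:
  fixes A B C :: "real ^ 2"
  assumes "B \<noteq> C"
  defines "a \<equiv> dist B C" and "b \<equiv> dist C A" and "c \<equiv> dist A B"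
  assumes h: "h = (b + c - a) * (c + a - b) * (a + b - c) / (4 * (a + b + c))"
  shows "tangent_to_side (side_barycenter A B C) r B C \<longleftrightarrow> 0 < r \<and> r = sqrt h"
proof -
  define T where "T = B + ((c + a - b) / (2 * a)) *\<^sub>R (C - B)"
  define Z where "Z = side_barycenter A B C"
  have a: "a > 0" and bc: "b \<ge> 0" "c \<ge> 0"
    using assms(1) by (simp_all add: a_def b_def c_def)
  define s where "s = a + b + c"
  have s: "s > 0" using a bc by (simp add: s_def)
  have tri: "b \<le> c + a" "c \<le> a + b"
    unfolding a_def b_def c_def
    by (metis dist_commute dist_triangle)+
  have k: "0 \<le> (c + a - b) / (2 * a)" "(c + a - b) / (2 * a) \<le> 1"
    using a tri by (simp_all add: field_simps)
  have "T = (1 - (c + a - b) / (2 * a)) *\<^sub>R B + ((c + a - b) / (2 * a)) *\<^sub>R C"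
    by (simp add: T_def algebra_simps)
  then have T: "T \<in> closed_segment B C" using k by (auto simp: in_segment)
  define u v e where "u = C - B" and "v = A - B" and "e = Z - B"
  have e: "e = (1 / s) *\<^sub>R (c *\<^sub>R u + a *\<^sub>R v)"
    using side_barycenter_from_vertex[OF assms(1), of A]
    unfolding side_barycenter_rotate[of A B C, symmetric]
    by (simp add: e_def Z_def s_def a_def b_def c_def u_def v_def dist_commute add_ac)
  have uu: "u \<bullet> u = a\<^sup>2" and vv: "v \<bullet> v = c\<^sup>2"
    by (simp_all add: u_def v_def a_def c_def dist_norm norm_minus_commute flip: power2_norm_eq_inner)
  have "b\<^sup>2 = (u - v) \<bullet> (u - v)"
    by (simp add: u_def v_def b_def dist_norm power2_norm_eq_inner)
  then have uv: "u \<bullet> v = (a\<^sup>2 + c\<^sup>2 - b\<^sup>2) / 2"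
    by (simp add: inner_diff_left inner_diff_right inner_commute uu vv)
  have "e \<bullet> u = (c * a\<^sup>2 + a * ((a\<^sup>2 + c\<^sup>2 - b\<^sup>2) / 2)) / s"
    unfolding e by (simp add: inner_add_left uu uv inner_commute[of v u])
  also have "\<dots> = a * (c + a - b) / 2"
    using s unfolding s_def by (simp add: field_simps power2_eq_square)
  finally have eu: "e \<bullet> u = a * (c + a - b) / 2" .
  have ZT: "Z - T = e - ((c + a - b) / (2 * a)) *\<^sub>R u"
    by (simp add: T_def u_def e_def)
  have perp: "(Z - T) \<bullet> (C - B) = 0"
    using a unfolding ZT by (simp add: inner_diff_left flip: u_def)
       (simp add: eu uu power2_eq_square)
  have ee: "e \<bullet> e = a * c * (c + a - b) / s"
  proof -
    have "e \<bullet> e = (c\<^sup>2 * a\<^sup>2 + a\<^sup>2 * c\<^sup>2 + 2 * a * c * ((a\<^sup>2 + c\<^sup>2 - b\<^sup>2) / 2)) / s\<^sup>2"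
      unfolding e using s
      by (simp add: inner_add_left inner_add_right uu vv uv inner_commute[of v u])
         (simp add: field_simps power2_eq_square)
    also have "\<dots> = a * c * (s * (c + a - b)) / s\<^sup>2"
    proof -
      have "c\<^sup>2 * a\<^sup>2 + a\<^sup>2 * c\<^sup>2 + 2 * a * c * ((a\<^sup>2 + c\<^sup>2 - b\<^sup>2) / 2) =
          a * c * (s * (c + a - b))"
        by (simp add: s_def field_simps power2_eq_square)
      then show ?thesis by (simp only:)
    qed
    finally show ?thesis using s by (simp add: power2_eq_square)
  qed
  have "(dist Z T)\<^sup>2 = (Z - T) \<bullet> (Z - T)"
    by (simp add: dist_norm power2_norm_eq_inner)
  also have "\<dots> = (Z - T) \<bullet> e"
    using perp unfolding ZT u_def[symmetric] by (simp add: inner_diff_right)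
  also have "\<dots> = a * c * (c + a - b) / s - (c + a - b)\<^sup>2 / 4"
    unfolding ZT using a
    by (simp add: inner_diff_left ee inner_commute[of u e] eu power2_eq_square)
  also have "\<dots> = h"
    unfolding h s_def[symmetric] using s by (simp add: field_simps) (simp add: s_def power2_eq_square algebra_simps)
  finally have "dist Z T = sqrt h" by (metis real_sqrt_unique zero_le_dist)
  then show ?thesis
    using tangent_to_side_iff[OF T perp] unfolding Z_def by simp
qed

text \<open>Heron's formula identifies \<open>h\<close> with the square of the area divided by the square of the
  semiperimeter, so it is positive for a nondegenerate triangle.\<close>

lemma inradius_eq:
  assumes nc: "\<not> collinear {A, B, C}"
  defines "a \<equiv> dist B C" and "b \<equiv> dist C A" and "c \<equiv> dist A B"
  defines "h \<equiv> (b + c - a) * (c + a - b) * (a + b - c) / (4 * (a + b + c))"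
  shows "inradius A B C = sqrt h" "h > 0"
proof -
  have ne: "B \<noteq> C" "C \<noteq> A" "A \<noteq> B" using nc by (auto simp: insert_commute)
  have "a > 0" using ne by (simp add: a_def)
  then have s: "a + b + c > 0" by (simp add: b_def c_def add_pos_nonneg)
  define d where "d = a + b + c"
  then have "d > 0" using s by simp
  have "4 * (cross2 (B - A) (C - A))\<^sup>2 = d * (4 * d * h)"
    using heron[of B A C] s
    by (simp add: h_def d_def flip: a_def b_def c_def)
  then have "h = (cross2 (B - A) (C - A))\<^sup>2 / d\<^sup>2"
    using \<open>d > 0\<close> by (simp add: field_simps power2_eq_square)
  then show h: "h > 0" using cross2_nonzero[OF nc] s by (simp add: d_def)
  have tangent: "tangent_to_side (side_barycenter A B C) r B C \<longleftrightarrow> 0 < r \<and> r = sqrt h"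
    "tangent_to_side (side_barycenter A B C) r C A \<longleftrightarrow> 0 < r \<and> r = sqrt h"
    "tangent_to_side (side_barycenter A B C) r A B \<longleftrightarrow> 0 < r \<and> r = sqrt h" for r
    subgoal by (rule incircle_tangent_to_side[OF ne(1)]) (simp add: h_def a_def b_def c_def)
    subgoal unfolding side_barycenter_rotate[of A B C]
      by (rule incircle_tangent_to_side[OF ne(2)]) (simp add: h_def a_def b_def c_def mult_ac add_ac)
    subgoal unfolding side_barycenter_rotate[of C A B, symmetric]
      by (rule incircle_tangent_to_side[OF ne(3)]) (simp add: h_def a_def b_def c_def mult_ac add_ac)
    done
  show "inradius A B C = sqrt h"
    unfolding inradius_def incenter_eq[OF nc] tangent
    using h by (intro the_equality) auto
qed

section \<open>Feuerbach's relation\<close>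

text \<open>The circumcenter, seen from \<open>A\<close>, has scalar products \<open>c\<^sup>2 / 2\<close> and \<open>b\<^sup>2 / 2\<close> with the two side
  vectors, and \<open>norm_from_inner_products\<close> converts them into its length.  Since \<open>cross2\<close> is twice
  the signed area, the result is the square of \<open>4 area R = a b c\<close>.\<close>

lemma circumradius_sides:
  fixes A B C Z :: "real ^ 2"
  assumes "dist Z A = dist Z B" "dist Z A = dist Z C"
  shows "4 * (cross2 (B - A) (C - A))\<^sup>2 * (dist Z A)\<^sup>2 = (dist B C * dist C A * dist A B)\<^sup>2"
proof -
  define b c where "b = dist C A" and "c = dist A B"
  define p where "p = (B - A) \<bullet> (C - A)"
  have u: "(B - A) \<bullet> (B - A) = c\<^sup>2" and v: "(C - A) \<bullet> (C - A) = b\<^sup>2"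
    by (simp_all add: b_def c_def dist_norm norm_minus_commute flip: power2_norm_eq_inner)
  have w: "(Z - A) \<bullet> (B - A) = c\<^sup>2 / 2" "(Z - A) \<bullet> (C - A) = b\<^sup>2 / 2"
    using assms dist_eq_iff_inner[of Z A B] dist_eq_iff_inner[of Z A C]
    by (simp_all add: b_def c_def dist_commute)
  have a: "(dist B C)\<^sup>2 = b\<^sup>2 + c\<^sup>2 - 2 * p"
    unfolding b_def c_def p_def dist_norm power2_norm_eq_inner
    by (simp add: algebra_simps inner_commute)
  have "(cross2 (B - A) (C - A))\<^sup>2 * (dist Z A)\<^sup>2
      = (cross2 (B - A) (C - A))\<^sup>2 * ((Z - A) \<bullet> (Z - A))"
    by (simp add: dist_norm power2_norm_eq_inner)
  also have "4 * \<dots> = (c\<^sup>2)\<^sup>2 * b\<^sup>2 + (b\<^sup>2)\<^sup>2 * c\<^sup>2 - 2 * c\<^sup>2 * b\<^sup>2 * p"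
    unfolding norm_from_inner_products u v w p_def[symmetric]
    by (simp add: field_simps)
  also have "\<dots> = (dist B C)\<^sup>2 * b\<^sup>2 * c\<^sup>2"
    unfolding a by (simp add: power2_eq_square algebra_simps)
  finally show ?thesis by (simp add: power_mult_distrib b_def c_def)
qed

text \<open>Polarization: each mixed scalar product is \<open>R\<^sup>2\<close> minus half of a squared side, and the
  \<open>R\<^sup>2\<close> terms recombine to the square of the sum of the coefficients.\<close>

lemma norm_sum3_sphere:
  fixes A B C Z :: "'a :: real_inner"
  assumes "dist Z A = dist Z B" "dist Z A = dist Z C"
  shows "(norm (x *\<^sub>R (A - Z) + y *\<^sub>R (B - Z) + z *\<^sub>R (C - Z)))\<^sup>2 =
    ((x + y + z) * dist Z A)\<^sup>2
      - (y * z * (dist B C)\<^sup>2 + z * x * (dist C A)\<^sup>2 + x * y * (dist A B)\<^sup>2)"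
proof -
  define u v w where "u = A - Z" and "v = B - Z" and "w = C - Z"
  have sq: "u \<bullet> u = (dist Z A)\<^sup>2" "v \<bullet> v = (dist Z A)\<^sup>2" "w \<bullet> w = (dist Z A)\<^sup>2"
    using assms by (simp_all add: u_def v_def w_def dist_norm norm_minus_commute flip: power2_norm_eq_inner)
  have d: "B - C = v - w" "C - A = w - u" "A - B = u - v" by (simp_all add: u_def v_def w_def)
  show ?thesis
    unfolding u_def[symmetric] v_def[symmetric] w_def[symmetric] dist_norm[of B C] dist_norm[of C A]
      dist_norm[of A B] d power2_norm_eq_inner
    by (simp add: inner_add_left inner_add_right inner_diff_left inner_diff_right inner_commute sq)
       (simp add: power2_eq_square algebra_simps inner_commute)
qed

theorem theorem2:
  fixes A B C :: "real ^ 2"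
  assumes "\<not> collinear {A, B, C}"
  shows "dist (incenter A B C) (nine_point_center A B C)
           = 1 / 2 * circumradius A B C - inradius A B C"
proof -
  obtain Z where Z: "dist Z A = dist Z B" "dist Z A = dist Z C"
    using equidistant_point_exists[OF assms] by blast
  define a b c where "a = dist B C" and "b = dist C A" and "c = dist A B"
  define x y z s where "x = (b + c - a) / 2" and "y = (c + a - b) / 2" and "z = (a + b - c) / 2"
    and "s = x + y + z"
  define R r where "R = dist Z A" and "r = inradius A B C"
  have abc: "a = y + z" "b = z + x" "c = x + y" by (simp_all add: x_def y_def z_def field_simps)
  have sides: "a + b + c = 2 * s" by (simp add: s_def abc)
  have nonneg: "x \<ge> 0" "y \<ge> 0" "z \<ge> 0"
    unfolding x_def y_def z_def a_def b_def c_def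
    using dist_triangle[of B C A] dist_triangle[of C A B] dist_triangle[of A B C]
    by (simp_all add: dist_commute)
  have "A \<noteq> B" using assms by auto
  then have "c > 0" by (simp add: c_def)
  then have s: "s > 0" using nonneg abc by (simp add: s_def)
  have R: "R \<ge> 0" by (simp add: R_def)
  define h where "h = (b + c - a) * (c + a - b) * (a + b - c) / (4 * (a + b + c))"
  have "h = x * y * z / s"
    unfolding h_def sides using s by (simp add: x_def y_def z_def field_simps)
  then have r: "r > 0" "r\<^sup>2 = x * y * z / s"
    using inradius_eq[OF assms] unfolding r_def h_def a_def b_def c_def by simp_all
  have "4 * (cross2 (B - A) (C - A))\<^sup>2 = (a + b + c) * (b + c - a) * (c + a - b) * (a + b - c)"
    unfolding a_def b_def c_def by (rule heron)
  also have "\<dots> = 16 * s * (x * y * z)"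
    by (simp add: sides x_def y_def z_def)
  also have "\<dots> = (4 * s * r)\<^sup>2"
    using s r(2) by (simp add: power_mult_distrib field_simps power2_eq_square)
  finally have "(4 * s * r * R)\<^sup>2 = (a * b * c)\<^sup>2"
    using circumradius_sides[OF Z] by (simp add: R_def a_def b_def c_def power_mult_distrib mult_ac)
  then have "4 * s * r * R = a * b * c"
    using s r(1) R by (subst (asm) power2_eq_iff_nonneg) (auto simp: a_def b_def c_def)
  then have rR: "r * R = a * b * c / (4 * s)"
    using s by (simp add: field_simps)
  have "2 * r \<le> R"
  proof -
    \<comment> \<open>The sum of squares whose nonnegativity is \<open>8 x y z \<le> (y + z) (z + x) (x + y)\<close>.\<close>
    have "0 \<le> x * (y - z)\<^sup>2 + y * (z - x)\<^sup>2 + z * (x - y)\<^sup>2" using nonneg by simp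
    also have "\<dots> = a * b * c - 8 * (x * y * z)"
      unfolding abc by (simp add: power2_eq_square algebra_simps)
    finally have "8 * (x * y * z) / (4 * s) \<le> a * b * c / (4 * s)"
      using s by (intro divide_right_mono) auto
    then have "r * (2 * r) \<le> r * R" using r(2) by (simp add: rR power2_eq_square)
    then show ?thesis using r(1) by simp
  qed
  have "incenter A B C - nine_point_center A B C =
      (- 1 / (2 * s)) *\<^sub>R (x *\<^sub>R (A - Z) + y *\<^sub>R (B - Z) + z *\<^sub>R (C - Z))"
  proof -
    have "nine_point_center A B C = (1 / (2 * s)) *\<^sub>R (s *\<^sub>R (A + B + C - Z))"
      using s nine_point_center_eq[OF assms Z] by simp
    moreover have "incenter A B C = (1 / (2 * s)) *\<^sub>R (a *\<^sub>R A + b *\<^sub>R B + c *\<^sub>R C)"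
      unfolding incenter_eq[OF assms] side_barycenter_def
      by (simp add: sides flip: a_def b_def c_def)
    ultimately have "incenter A B C - nine_point_center A B C = (1 / (2 * s)) *\<^sub>R
        (a *\<^sub>R A + b *\<^sub>R B + c *\<^sub>R C - s *\<^sub>R (A + B + C - Z))"
      by (simp only: scaleR_diff_right)
    also have "a *\<^sub>R A + b *\<^sub>R B + c *\<^sub>R C - s *\<^sub>R (A + B + C - Z) =
        - (x *\<^sub>R (A - Z) + y *\<^sub>R (B - Z) + z *\<^sub>R (C - Z))"
      by (simp add: abc s_def algebra_simps)
    finally show ?thesis
      by (simp only: minus_divide_left[symmetric] scaleR_minus_left scaleR_minus_right)
  qed
  then have "(dist (incenter A B C) (nine_point_center A B C))\<^sup>2 =
      (norm (x *\<^sub>R (A - Z) + y *\<^sub>R (B - Z) + z *\<^sub>R (C - Z)))\<^sup>2 / (4 * s\<^sup>2)"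
    using s by (simp add: dist_norm power_mult_distrib power_divide)
  also have "\<dots> = ((s * R)\<^sup>2 - (y * z * a\<^sup>2 + z * x * b\<^sup>2 + x * y * c\<^sup>2)) / (4 * s\<^sup>2)"
    unfolding norm_sum3_sphere[OF Z] by (simp add: s_def R_def a_def b_def c_def)
  also have "y * z * a\<^sup>2 + z * x * b\<^sup>2 + x * y * c\<^sup>2 = s * (a * b * c - 4 * (x * y * z))"
    unfolding abc s_def by (simp add: power2_eq_square algebra_simps)
  also have "((s * R)\<^sup>2 - s * (a * b * c - 4 * (x * y * z))) / (4 * s\<^sup>2) =
      R\<^sup>2 / 4 - a * b * c / (4 * s) + x * y * z / s"
    using s by (simp add: field_simps power2_eq_square)
  also have "\<dots> = (R / 2 - r)\<^sup>2"
    by (simp add: power2_diff r(2) power_divide flip: rR)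
  finally have "dist (incenter A B C) (nine_point_center A B C) = R / 2 - r"
    using \<open>2 * r \<le> R\<close> by (subst (asm) power2_eq_iff_nonneg) auto
  then show ?thesis
    using circumradius_eq[OF assms Z] by (simp add: R_def r_def)
qed

end
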